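(* Let $\sigma(w)=|\mathrm{Set}(w)|$ be an enumerative statistic equipped with an inclusion-exclusion structure. Then $\sigma$ is pattern-positive, and the coefficients of its pattern expansion are $\sigma_p=|\mathrm{ESet}(p)|$ for every $p\in\mathcal{S}$.
   Context: $S_n$ is the set of permutations of $[1,n]=\{1,\dots,n\}$ (with $S_0=\{\varnothing\}$), and $\mathcal{S}=\bigsqcup_{n\ge 0}S_n$. For $w\in S_n$ and $I=\{i_1<\dots<i_h\}\subseteq[1,n]$, $w|_I\in S_h$ is the permutation whose entries are in the same relative order as $w(i_1)\cdots w(i_h)$. The pattern-count function $[p]\colon\mathcal{S}\to\mathbb{N}$ sends $w\in S_n$ to the number of $I\subseteq[1,n]$ with $w|_I=p$. Every permutation statistic $\sigma\colon\mathcal{S}\to\mathbb{Z}$ has a unique pattern expansion $\sigma=\sum_{p\in\mathcal{S}}\sigma_p\cdot[p]$ with $\sigma_p\in\mathbb{Z}$ (a possibly infinite sum, finite when evaluated at any $w$). The statistic is pattern-positive if all $\sigma_p\ge 0$. An enumerative statistic is a statistic given by $\sigma(w)=|\mathrm{Set}(w)|$ for some finite set $\mathrm{Set}(w)$ associated to each $w\in\mathcal{S}$. An inclusion-exclusion structure for it is a family of injective maps $\iota_I\colon\mathrm{Set}(w|_I)\hookrightarrow\mathrm{Set}(w)$, one for each $w\in S_n$ and $I\subseteq[1,n]$ (i.e. indexed by pattern occurrences in $w$), that respects intersections: for all $w\in S_n$ and $I,J\subseteq[1,n]$, $$\iota_{I\cap J}(\mathrm{Set}(w|_{I\cap J}))=\iota_I(\mathrm{Set}(w|_I))\cap\iota_J(\mathrm{Set}(w|_J))$$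 as subsets of $\mathrm{Set}(w)$. Given such a structure, an element $a\in\mathrm{Set}(w)$, $w\in S_n$, is essential if it is not in the image of $\iota_I$ for any proper subset $I\subsetneq[1,n]$ (the empty set $I=\varnothing$ included when $n\ge 1$). $\mathrm{ESet}(w)\subseteq\mathrm{Set}(w)$ is the set of essential elements. *)

theory Defs
  imports Main "HOL-Combinatorics.Multiset_Permutations"
begin

section \<open>Permutations and patterns\<close>

text \<open>Permutations of \<open>{1..n}\<close>, for all \<open>n\<close> together, in one-line notation.\<close>

typedef permutation = "\<Union>n. permutations_of_set {1..n::nat}"
  morphisms one_line Permutation
proof -
  have "[] \<in> permutations_of_set {1..0::nat}" by (simp add: permutations_of_set_def)
  then show ?thesis by blast
qed

setup_lifting type_definition_permutation

lift_definition psize :: "permutation \<Rightarrow> nat" is length .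

text \<open>Replace every entry of a word by its rank among the entries of the word.\<close>

definition standardize :: "nat list \<Rightarrow> nat list" where
  "standardize v = map (\<lambda>x. card {y \<in> set v. y \<le> x}) v"

lemma length_standardize [simp]: "length (standardize v) = length v"
  by (simp add: standardize_def)

lemma rank_less_iff:
  assumes "x \<in> set v" "x' \<in> set v"
  shows "card {y \<in> set v. y \<le> x} < card {y \<in> set v. y \<le> x'} \<longleftrightarrow> x < (x'::nat)"
proof -
  have *: "card {y \<in> set v. y \<le> a} < card {y \<in> set v. y \<le> b}"
    if "a < b" "b \<in> set v" for a b
  proof (rule psubset_card_mono)
    have "b \<in> {y \<in> set v. y \<le> b}" "b \<notin> {y \<in> set v. y \<le> a}" using that by auto
    moreover have "{y \<in> set v. y \<le> a} \<subseteq> {y \<in> set v. y \<le> b}" using that by auto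
    ultimately show "{y \<in> set v. y \<le> a} \<subset> {y \<in> set v. y \<le> b}" by blast
  qed simp
  show ?thesis using *[of x x'] *[of x' x] assms by (cases x x' rule: linorder_cases) auto
qed

lemma standardize_less_iff:
  assumes "i < length v" "j < length v"
  shows "standardize v ! i < standardize v ! j \<longleftrightarrow> v ! i < v ! j"
  using assms by (simp add: standardize_def rank_less_iff)

lemma standardize_in:
  assumes "distinct v"
  shows "standardize v \<in> permutations_of_set {1..length v}"
proof -
  let ?r = "\<lambda>x. card {y \<in> set v. y \<le> x}"
  have inj: "inj_on ?r (set v)"
  proof (rule inj_onI)
    fix x x' assume "x \<in> set v" "x' \<in> set v" "?r x = ?r x'"
    then show "x = x'" using rank_less_iff[of x v x'] rank_less_iff[of x' v x] by linarith
  qed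
  have "?r x \<in> {1..length v}" if "x \<in> set v" for x
  proof -
    have "{y \<in> set v. y \<le> x} \<noteq> {}" using that by blast
    then have "?r x \<ge> 1" by (simp add: Suc_le_eq card_gt_0_iff)
    moreover have "?r x \<le> card (set v)" by (intro card_mono) auto
    ultimately show ?thesis using distinct_card[OF assms] by simp
  qed
  then have "?r ` set v = {1..length v}"
    using card_image[OF inj] distinct_card[OF assms] by (intro card_subset_eq) auto
  then show ?thesis using assms inj
    by (auto simp: permutations_of_set_def standardize_def distinct_map)
qed

text \<open>The pattern of \<open>w\<close> at the positions \<open>I\<close>. Positions are counted from 1, whereas
  \<^const>\<open>nths\<close> counts from 0.\<close>

lift_definition pat_restrict :: "permutation \<Rightarrow> nat set \<Rightarrow> permutation" is
  "\<lambda>w I. standardize (nths w {i. Suc i \<in> I})"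
proof -
  fix w :: "nat list" and I :: "nat set"
  assume "w \<in> (\<Union>n. permutations_of_set {1..n})"
  then have "distinct w" by (blast dest: permutations_of_setD)
  then have "distinct (nths w {i. Suc i \<in> I})" by (rule distinct_nthsI)
  then have "standardize (nths w {i. Suc i \<in> I}) \<in>
      permutations_of_set {1..length (nths w {i. Suc i \<in> I})}"
    by (rule standardize_in)
  then show "standardize (nths w {i. Suc i \<in> I}) \<in> (\<Union>n. permutations_of_set {1..n})"
    by (rule UN_I[where B = "\<lambda>n. permutations_of_set {1..n}", OF UNIV_I])
qed

definition pat_count :: "permutation \<Rightarrow> permutation \<Rightarrow> nat" where
  "pat_count p w = card {I. I \<subseteq> {1..psize w} \<and> pat_restrict w I = p}"

lemma psize_pat_restrict:
  assumes "I \<subseteq> {1..psize w}"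
  shows "psize (pat_restrict w I) = card I"
  using assms
proof (transfer, goal_cases)
  case (1 I w)
  have "I = Suc ` {i. i < length w \<and> Suc i \<in> I}"
  proof (intro equalityI subsetI)
    fix j assume j: "j \<in> I"
    then have "j \<in> {1..length w}" using 1 by blast
    then obtain i where "j = Suc i" "i < length w" by (cases j) auto
    then show "j \<in> Suc ` {i. i < length w \<and> Suc i \<in> I}" using j by blast
  next
    fix j assume "j \<in> Suc ` {i. i < length w \<and> Suc i \<in> I}"
    then show "j \<in> I" by blast
  qed
  then have "card I = card {i. i < length w \<and> Suc i \<in> I}"
    by (metis card_image inj_Suc)
  then show ?case by (simp add: length_nths)
qed

lemma pat_restrict_full: "pat_restrict w {1..psize w} = w"
proof (transfer, goal_cases)
  case (1 w)
  then obtain n where "w \<in> permutations_of_set {1..n}" by blast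
  then have n: "set w = {1..n}" by (rule permutations_of_setD)
  have "nths w {i. Suc i \<in> {1..length w}} = w"
    by (rule nths_all) (simp add: Suc_le_eq)
  moreover have "card {y \<in> set w. y \<le> x} = x" if "x \<in> set w" for x
  proof -
    have "{y \<in> set w. y \<le> x} = {1..x}" using that unfolding n by fastforce
    then show ?thesis by simp
  qed
  ultimately show ?case by (simp add: standardize_def map_idI)
qed

lemma pat_count_nonzeroE:
  assumes "pat_count p w \<noteq> 0"
  obtains I where "I \<subseteq> {1..psize w}" "p = pat_restrict w I"
proof -
  have "{I. I \<subseteq> {1..psize w} \<and> pat_restrict w I = p} \<noteq> {}"
    using assms unfolding pat_count_def by (metis card.empty)
  then show thesis using that by blast
qed

lemma finite_patterns: "finite {p. pat_count p w \<noteq> 0}"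
proof (rule finite_subset)
  show "{p. pat_count p w \<noteq> 0} \<subseteq> pat_restrict w ` Pow {1..psize w}"
  proof
    fix p assume "p \<in> {p. pat_count p w \<noteq> 0}"
    then have "pat_count p w \<noteq> 0" by simp
    then obtain I where "I \<subseteq> {1..psize w}" "p = pat_restrict w I"
      by (rule pat_count_nonzeroE)
    then show "p \<in> pat_restrict w ` Pow {1..psize w}" by blast
  qed
qed simp

lemma proper_occurrence_smaller:
  assumes "I \<subset> {1..psize w}"
  shows "psize (pat_restrict w I) < psize w"
proof -
  have "card I < card {1..psize w}" using assms by (intro psubset_card_mono) auto
  moreover have "psize (pat_restrict w I) = card I" using assms by (intro psize_pat_restrict) blast
  ultimately show ?thesis by simp
qed

lemma pattern_cases:
  assumes "pat_count p w \<noteq> 0"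
  shows "psize p < psize w \<or> p = w"
proof -
  obtain I where "I \<subseteq> {1..psize w}" "p = pat_restrict w I"
    using assms by (rule pat_count_nonzeroE)
  then show ?thesis
    using pat_restrict_full[of w] proper_occurrence_smaller[of I w]
    by (cases "I = {1..psize w}") (simp_all only: psubset_eq, blast+)
qed

lemma pat_count_self: "pat_count w w = 1"
proof -
  have "I = {1..psize w}" if "I \<subseteq> {1..psize w}" "pat_restrict w I = w" for I
    using proper_occurrence_smaller[of I w] that by (metis less_irrefl psubsetI)
  then have "{I. I \<subseteq> {1..psize w} \<and> pat_restrict w I = w} = {{1..psize w}}"
    using pat_restrict_full by blast
  then show ?thesis by (simp add: pat_count_def)
qed


section \<open>Pattern expansions\<close>

text \<open>For fixed \<open>w\<close> only finitely many terms \<open>c p * [p](w)\<close> of the expansion can be nonzero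
  (\<open>finite_patterns\<close>), so the sum is a finite one.\<close>

definition is_pat_expansion :: "(permutation \<Rightarrow> int) \<Rightarrow> (permutation \<Rightarrow> int) \<Rightarrow> bool" where
  "is_pat_expansion \<sigma> c \<longleftrightarrow>
     (\<forall>w. \<sigma> w = (\<Sum>p | pat_count p w \<noteq> 0. c p * int (pat_count p w)))"

lemma pat_sum_split:
  "(\<Sum>p | pat_count p w \<noteq> 0. c p * int (pat_count p w)) =
     c w + (\<Sum>p | pat_count p w \<noteq> 0 \<and> psize p < psize w. c p * int (pat_count p w))"
proof -
  have *: "{p. pat_count p w \<noteq> 0} = insert w {p. pat_count p w \<noteq> 0 \<and> psize p < psize w}"
  proof (intro equalityI subsetI)
    fix p assume "p \<in> {p. pat_count p w \<noteq> 0}"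
    then show "p \<in> insert w {p. pat_count p w \<noteq> 0 \<and> psize p < psize w}"
      using pattern_cases[of p w] by blast
  next
    fix p assume "p \<in> insert w {p. pat_count p w \<noteq> 0 \<and> psize p < psize w}"
    then show "p \<in> {p. pat_count p w \<noteq> 0}"
      using pat_count_self[of w] by auto
  qed
  moreover have "finite {p. pat_count p w \<noteq> 0 \<and> psize p < psize w}"
    using finite_patterns[of w] by (rule rev_finite_subset) auto
  ultimately show ?thesis by (simp add: pat_count_self)
qed

function triangular_coeff :: "(permutation \<Rightarrow> int) \<Rightarrow> permutation \<Rightarrow> int" where
  "triangular_coeff \<sigma> w = \<sigma> w -
     (\<Sum>p | pat_count p w \<noteq> 0 \<and> psize p < psize w. triangular_coeff \<sigma> p * int (pat_count p w))"
  by auto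
termination by (relation "measure (psize \<circ> snd)") auto

declare triangular_coeff.simps [simp del]

theorem pat_expansion_unique: "\<exists>!c. is_pat_expansion \<sigma> c"
proof (rule ex1I)
  show "is_pat_expansion \<sigma> (triangular_coeff \<sigma>)"
    unfolding is_pat_expansion_def pat_sum_split
    by (subst triangular_coeff.simps) simp
next
  fix c assume c: "is_pat_expansion \<sigma> c"
  have "c w = triangular_coeff \<sigma> w" for w
  proof (induction "psize w" arbitrary: w rule: less_induct)
    case less
    have "\<sigma> w = c w +
        (\<Sum>p | pat_count p w \<noteq> 0 \<and> psize p < psize w. c p * int (pat_count p w))"
      using c unfolding is_pat_expansion_def pat_sum_split by blast
    also have "(\<Sum>p | pat_count p w \<noteq> 0 \<and> psize p < psize w. c p * int (pat_count p w)) =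
        (\<Sum>p | pat_count p w \<noteq> 0 \<and> psize p < psize w.
           triangular_coeff \<sigma> p * int (pat_count p w))"
      by (intro sum.cong) (auto simp: less)
    finally show ?case by (subst triangular_coeff.simps) simp
  qed
  then show "c = triangular_coeff \<sigma>" by blast
qed

text \<open>The coefficients \<open>\<sigma>\<^sub>p\<close>; well defined by \<open>pat_expansion_unique\<close>.\<close>

definition pat_coeff :: "(permutation \<Rightarrow> int) \<Rightarrow> permutation \<Rightarrow> int" where
  "pat_coeff \<sigma> = (THE c. is_pat_expansion \<sigma> c)"

definition pat_positive :: "(permutation \<Rightarrow> int) \<Rightarrow> bool" where
  "pat_positive \<sigma> \<longleftrightarrow> (\<forall>p. pat_coeff \<sigma> p \<ge> 0)"


section \<open>Inclusion-exclusion structures\<close>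

definition enumerates :: "(permutation \<Rightarrow> 'a set) \<Rightarrow> (permutation \<Rightarrow> int) \<Rightarrow> bool" where
  "enumerates St \<sigma> \<longleftrightarrow> (\<forall>w. finite (St w) \<and> \<sigma> w = int (card (St w)))"

text \<open>\<open>\<iota> w I\<close> is the map \<open>Set (w|\<^sub>I) \<rightarrow> Set w\<close>; it depends on the occurrence \<open>I\<close> and on \<open>w\<close>, and
  there is no compatibility with composition. Its values outside of \<open>Set (w|\<^sub>I)\<close>, or for \<open>I\<close> not
  contained in \<open>{1..psize w}\<close>, are irrelevant.\<close>

definition incl_excl_structure ::
    "(permutation \<Rightarrow> 'a set) \<Rightarrow> (permutation \<Rightarrow> nat set \<Rightarrow> 'a \<Rightarrow> 'a) \<Rightarrow> bool" where
  "incl_excl_structure St \<iota> \<longleftrightarrow>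
     (\<forall>w I. I \<subseteq> {1..psize w} \<longrightarrow>
        \<iota> w I ` St (pat_restrict w I) \<subseteq> St w \<and> inj_on (\<iota> w I) (St (pat_restrict w I))) \<and>
     (\<forall>w I J. I \<subseteq> {1..psize w} \<longrightarrow> J \<subseteq> {1..psize w} \<longrightarrow>
        \<iota> w (I \<inter> J) ` St (pat_restrict w (I \<inter> J)) =
          \<iota> w I ` St (pat_restrict w I) \<inter> \<iota> w J ` St (pat_restrict w J))"

definition essential_set ::
    "(permutation \<Rightarrow> 'a set) \<Rightarrow> (permutation \<Rightarrow> nat set \<Rightarrow> 'a \<Rightarrow> 'a) \<Rightarrow> permutation \<Rightarrow> 'a set" where
  "essential_set St \<iota> w =
     {a \<in> St w. \<forall>I. I \<subset> {1..psize w} \<longrightarrow> a \<notin> \<iota> w I ` St (pat_restrict w I)}"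

end

theory Submission
  imports Defs
begin

text \<open>
  Write \<open>A I\<close> for the image of \<open>\<iota> w I\<close>, a subset of \<open>St w\<close> with \<open>\<sigma> (pat_restrict w I)\<close> elements.
  As the \<open>A I\<close> are closed under intersection, each element of \<open>A I\<close> has a unique smallest position
  set \<open>J \<subseteq> I\<close> with \<open>A J\<close> containing it, and so \<open>\<sigma> (pat_restrict w I)\<close> is the sum over \<open>J \<subseteq> I\<close> of the
  number \<open>e J\<close> of elements of \<open>A J\<close> lying in no \<open>A K\<close> with \<open>K \<subset> J\<close>
  (\<open>card_eq_sum_new_elements\<close>).

  On the other hand, let \<open>c\<close> be the coefficients of the pattern expansion of \<open>\<sigma>\<close>. Restricting a
  permutation twice is the same as restricting it once, so the occurrences of patterns in
  \<open>pat_restrict w I\<close> are the occurrences \<open>J \<subseteq> I\<close> of patterns in \<open>w\<close>, and \<open>\<sigma> (pat_restrict w I)\<close> is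
  also the sum over \<open>J \<subseteq> I\<close> of \<open>c (pat_restrict w J)\<close> (\<open>expansion_of_restriction\<close>).

  Two functions on the subsets of a finite set that have the same sums over all power sets are equal
  (\<open>subset_sums_determine\<close>). Thus \<open>e J = c (pat_restrict w J)\<close>, and \<open>J = {1..psize w}\<close> gives the
  claim, since \<open>e J\<close> then counts the essential elements.
\<close>


section \<open>Sums over subsets\<close>

text \<open>The uniqueness part of Moebius inversion: the sum over \<open>Pow X\<close> contains \<open>f X\<close> and otherwise only
  values at smaller sets, which are known by induction.\<close>

lemma subset_sums_determine:
  fixes f g :: "'b set \<Rightarrow> 'c::ab_group_add"
  assumes "finite X"
    and "\<And>I. I \<subseteq> X \<Longrightarrow> (\<Sum>J\<in>Pow I. f J) = (\<Sum>J\<in>Pow I. g J)"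
  shows "f X = g X"
  using assms
proof (induction X rule: finite_psubset_induct)
  case (psubset X)
  have split: "(\<Sum>J\<in>Pow X. h J) = h X + (\<Sum>J\<in>Pow X - {X}. h J)" for h :: "'b set \<Rightarrow> 'c"
    using psubset.hyps by (intro sum.remove) auto
  have "f J = g J" if "J \<in> Pow X - {X}" for J
    using that by (intro psubset.IH) (auto intro!: psubset.prems)
  then have "(\<Sum>J\<in>Pow X - {X}. f J) = (\<Sum>J\<in>Pow X - {X}. g J)" by (rule sum.cong[OF refl])
  then show ?case using psubset.prems[OF subset_refl] by (simp add: split)
qed

text \<open>The sets \<open>A J - (\<Union>K\<in>{K. K \<subset> J}. A K)\<close> partition \<open>A I\<close>: an element belongs to the part of a
  smallest \<open>J\<close> with \<open>A J\<close> containing it. Two minimal index sets \<open>J\<close> and \<open>J'\<close> coincide, because \<open>J \<inter> J'\<close>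
  would otherwise be a smaller one.\<close>

lemma card_eq_sum_new_elements:
  assumes "finite I"
    and fin: "finite (A I)"
    and inter: "\<And>J K. J \<subseteq> I \<Longrightarrow> K \<subseteq> I \<Longrightarrow> A (J \<inter> K) = A J \<inter> A K"
  shows "card (A I) = (\<Sum>J\<in>Pow I. card (A J - (\<Union>K\<in>{K. K \<subset> J}. A K)))"
proof -
  let ?new = "\<lambda>J. A J - (\<Union>K\<in>{K. K \<subset> J}. A K)"
  have sub: "A J \<subseteq> A I" if "J \<subseteq> I" for J
    using inter[of J I] that by (auto simp: Int_absorb2)
  have "A I \<subseteq> (\<Union>J\<in>Pow I. ?new J)"
  proof
    fix a assume "a \<in> A I"
    define S where "S = {J. J \<subseteq> I \<and> a \<in> A J}"
    have "finite S" "I \<in> S" using \<open>finite I\<close> \<open>a \<in> A I\<close> by (simp_all add: S_def)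
    then have "\<exists>J\<in>S. J \<subseteq> I \<and> (\<forall>K\<in>S. K \<subseteq> J \<longrightarrow> J = K)" by (rule finite_has_minimal2)
    then obtain J where "J \<in> S" and min: "\<forall>K\<in>S. K \<subseteq> J \<longrightarrow> J = K" by blast
    then have J: "J \<subseteq> I" "a \<in> A J" by (simp_all add: S_def)
    have "a \<notin> A K" if "K \<subset> J" for K
    proof
      assume "a \<in> A K"
      then have "K \<in> S" using that J(1) by (auto simp: S_def)
      then show False using min that by blast
    qed
    then show "a \<in> (\<Union>J\<in>Pow I. ?new J)" using J by (intro UN_I[of J]) simp_all
  qed
  moreover have "(\<Union>J\<in>Pow I. ?new J) \<subseteq> A I" using sub by (intro UN_least) auto
  ultimately have union: "A I = (\<Union>J\<in>Pow I. ?new J)" by (rule subset_antisym)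
  have disjoint: "?new J \<inter> ?new J' = {}" if "J \<in> Pow I" "J' \<in> Pow I" "J \<noteq> J'" for J J'
  proof (rule equals0I)
    fix a assume a: "a \<in> ?new J \<inter> ?new J'"
    then have "a \<in> A (J \<inter> J')" using inter[of J J'] that by simp
    moreover have "J \<inter> J' \<subset> J \<or> J \<inter> J' \<subset> J'" using \<open>J \<noteq> J'\<close> by blast
    ultimately show False using a by auto
  qed
  have "card (\<Union>J\<in>Pow I. ?new J) = (\<Sum>J\<in>Pow I. card (?new J))"
    using \<open>finite I\<close> disjoint finite_subset[OF sub fin]
    by (intro card_UN_disjoint) auto
  then show ?thesis by (simp only: union[symmetric])
qed


section \<open>Patterns of patterns\<close>

definition rank_in :: "nat set \<Rightarrow> nat \<Rightarrow> nat" where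
  "rank_in I i = card {j \<in> I. j \<le> i}"

lemma rank_in_less_iff:
  assumes "finite I" "i \<in> I" "j \<in> I"
  shows "rank_in I i < rank_in I j \<longleftrightarrow> i < j"
  using rank_less_iff[of i "sorted_list_of_set I" j] assms by (simp add: rank_in_def)

lemma bij_betw_rank_in:
  assumes "finite I"
  shows "bij_betw (rank_in I) I {1..card I}"
proof -
  have inj: "inj_on (rank_in I) I"
  proof (rule inj_onI)
    fix i j assume "i \<in> I" "j \<in> I" "rank_in I i = rank_in I j"
    then show "i = j"
      using rank_in_less_iff[OF assms, of i j] rank_in_less_iff[OF assms, of j i] by auto
  qed
  have "rank_in I i \<in> {1..card I}" if "i \<in> I" for i
  proof -
    have "{j \<in> I. j \<le> i} \<noteq> {}" using that by blast
    then have "rank_in I i \<ge> 1" using assms by (simp add: rank_in_def Suc_le_eq card_gt_0_iff)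
    moreover have "rank_in I i \<le> card I"
      unfolding rank_in_def using assms by (intro card_mono) auto
    ultimately show ?thesis by simp
  qed
  then have "rank_in I ` I = {1..card I}"
    using card_image[OF inj] by (intro card_subset_eq) auto
  then show ?thesis using inj by (simp add: bij_betw_def)
qed

lemma standardize_map:
  assumes "\<And>x y. x \<in> set v \<Longrightarrow> y \<in> set v \<Longrightarrow> f x < f y \<longleftrightarrow> x < y"
  shows "standardize (map f v) = standardize v"
proof -
  have "card {y \<in> f ` set v. y \<le> f x} = card {y \<in> set v. y \<le> x}" if "x \<in> set v" for x
  proof -
    have "{y \<in> f ` set v. y \<le> f x} = f ` {y \<in> set v. y \<le> x}"
      using assms that by (fastforce simp flip: not_less)
    moreover have "inj_on f {y \<in> set v. y \<le> x}"
    proof (rule inj_onI)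
      fix a b assume "a \<in> {y \<in> set v. y \<le> x}" "b \<in> {y \<in> set v. y \<le> x}" "f a = f b"
      then show "a = b" using assms[of a b] assms[of b a] by auto
    qed
    ultimately show ?thesis by (simp add: card_image)
  qed
  then show ?thesis by (simp add: standardize_def)
qed

text \<open>Passing to ranks is strictly increasing on the entries of \<open>v\<close>, so it does not change the relative
  order of any subword.\<close>

lemma standardize_nths_standardize:
  "standardize (nths (standardize v) B) = standardize (nths v B)"
proof -
  let ?r = "\<lambda>x. card {y \<in> set v. y \<le> x}"
  have "standardize (nths (standardize v) B) = standardize (map ?r (nths v B))"
    by (simp add: standardize_def[of v] nths_map)
  also have "\<dots> = standardize (nths v B)"
    using set_nths_subset[of v B] by (intro standardize_map rank_less_iff) blast+
  finally show ?thesis .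
qed

text \<open>Positions in the pattern of \<open>w\<close> at \<open>I\<close> are the ranks of the positions \<open>i \<in> I\<close> of \<open>w\<close>, so a set
  of positions in this pattern has the form \<open>rank_in I ` J\<close>.\<close>

lemma pat_restrict_pat_restrict:
  assumes "I \<subseteq> {1..psize w}" "J \<subseteq> I"
  shows "pat_restrict (pat_restrict w I) (rank_in I ` J) = pat_restrict w J"
  using assms
proof (transfer, goal_cases)
  case (1 I w J)
  let ?I = "{i. Suc i \<in> I}" and ?B = "{i. Suc i \<in> rank_in I ` J}" and ?J = "{i. Suc i \<in> J}"
  have fin: "finite I" using 1(2) by (rule finite_subset) simp
  \<comment> \<open>Indices of lists start at 0 and positions at 1. As 0 is not in \<open>I\<close>, the index \<open>i\<close> in \<open>w\<close> becomes
    the index one below the rank of the position \<open>Suc i\<close>.\<close>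
  have rank: "Suc (card {i' \<in> ?I. i' < i}) = rank_in I (Suc i)" if "Suc i \<in> I" for i
  proof -
    have "{j \<in> I. j \<le> Suc i} = Suc ` insert i {i' \<in> ?I. i' < i}" (is "?L = ?R")
    proof (intro equalityI subsetI)
      fix j assume j: "j \<in> ?L"
      then have "j \<in> {1..length w}" using 1(2) by blast
      then obtain k where "j = Suc k" by (cases j) auto
      then show "j \<in> ?R" using j by auto
    qed (use that in auto)
    then have "rank_in I (Suc i) = card (insert i {i' \<in> ?I. i' < i})"
      unfolding rank_in_def by (simp only: card_image inj_Suc)
    then show ?thesis by simp
  qed
  have "inj_on (rank_in I) I" using bij_betw_rank_in[OF fin] by (rule bij_betw_imp_inj_on)
  then have "rank_in I i \<in> rank_in I ` J \<longleftrightarrow> i \<in> J" if "i \<in> I" for i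
    using that 1(3) by (rule inj_on_image_mem_iff)
  then have "card {i' \<in> ?I. i' < i} \<in> ?B \<longleftrightarrow> i \<in> ?J" if "i \<in> ?I" for i
    using that rank[of i] by simp
  moreover have "?J \<subseteq> ?I" using 1(3) by blast
  ultimately have "{i \<in> ?I. \<exists>j\<in>?B. card {i' \<in> ?I. i' < i} = j} = ?J" by blast
  then have "nths (nths w ?I) ?B = nths w ?J"
    by (simp only: nths_nths)
  then show ?case by (simp only: standardize_nths_standardize)
qed


section \<open>Expansions as sums over occurrences\<close>

text \<open>Group the occurrences by their pattern; each \<open>p\<close> arises \<open>pat_count p w\<close> times.\<close>

lemma sum_occurrences:
  "(\<Sum>p | pat_count p w \<noteq> 0. c p * int (pat_count p w)) =
     (\<Sum>I\<in>Pow {1..psize w}. c (pat_restrict w I))"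
proof -
  let ?P = "Pow {1..psize w}"
  have patterns: "{p. pat_count p w \<noteq> 0} = pat_restrict w ` ?P"
    by (auto simp: pat_count_def card_eq_0_iff)
  have "(\<Sum>I\<in>?P. c (pat_restrict w I)) =
      (\<Sum>p\<in>pat_restrict w ` ?P. \<Sum>I\<in>{I\<in>?P. pat_restrict w I = p}. c (pat_restrict w I))"
    by (rule sum.image_gen) simp
  also have "\<dots> = (\<Sum>p\<in>pat_restrict w ` ?P. c p * int (pat_count p w))"
    by (intro sum.cong) (simp_all add: pat_count_def)
  finally show ?thesis by (simp only: patterns)
qed

text \<open>By \<open>pat_restrict_pat_restrict\<close>, ranks match the occurrences inside \<open>I\<close> of patterns in \<open>w\<close> with
  the occurrences of the same patterns in \<open>pat_restrict w I\<close>.\<close>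

lemma expansion_of_restriction:
  assumes "is_pat_expansion \<sigma> c" "I \<subseteq> {1..psize w}"
  shows "\<sigma> (pat_restrict w I) = (\<Sum>J\<in>Pow I. c (pat_restrict w J))"
proof -
  let ?v = "pat_restrict w I"
  have fin: "finite I" using assms(2) by (rule finite_subset) simp
  have "bij_betw ((`) (rank_in I)) (Pow I) (Pow {1..psize ?v})"
    using bij_betw_rank_in[OF fin] psize_pat_restrict[OF assms(2)] by (simp add: bij_betw_Pow)
  then have "(\<Sum>K\<in>Pow {1..psize ?v}. c (pat_restrict ?v K)) =
      (\<Sum>J\<in>Pow I. c (pat_restrict ?v (rank_in I ` J)))"
    by (rule sum.reindex_bij_betw[symmetric])
  also have "\<dots> = (\<Sum>J\<in>Pow I. c (pat_restrict w J))"
    using assms(2) by (intro sum.cong) (simp_all add: pat_restrict_pat_restrict)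
  finally show ?thesis
    using assms(1) by (simp only: is_pat_expansion_def sum_occurrences)
qed


section \<open>Essential elements\<close>

theorem proposition4p3:
  fixes \<sigma> :: "permutation \<Rightarrow> int"
    and St :: "permutation \<Rightarrow> 'a set"
    and \<iota> :: "permutation \<Rightarrow> nat set \<Rightarrow> 'a \<Rightarrow> 'a"
  assumes "enumerates St \<sigma>"
    and "incl_excl_structure St \<iota>"
  shows "pat_positive \<sigma> \<and> (\<forall>p. pat_coeff \<sigma> p = int (card (essential_set St \<iota> p)))"
proof -
  have expansion: "is_pat_expansion \<sigma> (pat_coeff \<sigma>)"
    unfolding pat_coeff_def by (rule theI'[OF pat_expansion_unique])
  have "pat_coeff \<sigma> w = int (card (essential_set St \<iota> w))" for w
  proof -
    let ?X = "{1..psize w}"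
    define A where "A I = \<iota> w I ` St (pat_restrict w I)" for I
    have fin: "finite (St v)" and size: "\<sigma> v = int (card (St v))" for v
      using assms(1) by (simp_all add: enumerates_def)
    have sub: "A I \<subseteq> St w" and inj: "inj_on (\<iota> w I) (St (pat_restrict w I))" if "I \<subseteq> ?X" for I
      using assms(2) that by (simp_all add: incl_excl_structure_def A_def)
    have inter: "A (I \<inter> J) = A I \<inter> A J" if "I \<subseteq> ?X" "J \<subseteq> ?X" for I J
      using assms(2) that by (simp add: incl_excl_structure_def A_def)
    let ?e = "\<lambda>J. int (card (A J - (\<Union>K\<in>{K. K \<subset> J}. A K)))"
    have sums: "(\<Sum>J\<in>Pow I. ?e J) = (\<Sum>J\<in>Pow I. pat_coeff \<sigma> (pat_restrict w J))" if I: "I \<subseteq> ?X" for I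
    proof -
      have "card (A I) = (\<Sum>J\<in>Pow I. card (A J - (\<Union>K\<in>{K. K \<subset> J}. A K)))"
      proof (rule card_eq_sum_new_elements)
        show "finite I" using I by (rule finite_subset) simp
        show "finite (A I)" by (simp add: A_def fin)
        show "A (J \<inter> K) = A J \<inter> A K" if "J \<subseteq> I" "K \<subseteq> I" for J K
          using that I by (intro inter) auto
      qed
      moreover have "int (card (A I)) = \<sigma> (pat_restrict w I)"
        using inj[OF I] by (simp add: A_def card_image size)
      ultimately show ?thesis using expansion_of_restriction[OF expansion I] by simp
    qed
    have "?e ?X = pat_coeff \<sigma> (pat_restrict w ?X)"
      by (rule subset_sums_determine[OF finite_atLeastAtMost sums])
    \<comment> \<open>\<open>\<iota> w ?X\<close> need not be the identity, but it maps the finite set \<open>St w\<close> injectively to itself.\<close>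
    moreover have "A ?X = St w"
      using endo_inj_surj[OF fin[of w], of "\<iota> w ?X"] sub[of ?X] inj[of ?X]
      by (simp only: A_def pat_restrict_full subset_refl)
    then have "A ?X - (\<Union>K\<in>{K. K \<subset> ?X}. A K) = essential_set St \<iota> w"
      by (auto simp: essential_set_def A_def)
    ultimately show ?thesis by (simp only: pat_restrict_full)
  qed
  then show ?thesis by (simp add: pat_positive_def)
qed

end
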